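(* Let $G$ be a bipartite graph with parts $V_1$ and $V_2$. Then there is a square-free quadratic Gröbner basis of $I_{G\to\Lambda}$ given by the binomials $$ r_{A,B}\,r_{C,D}-r_{A\cap C,\,B\cup D}\;r_{A\cup C,\,B\cap D}, $$ where $A,C\subseteq V_1$, $B,D\subseteq V_2$ and both $A\cup B$ and $C\cup D$ are independent sets of $G$.
   Context: Graphs are finite and undirected without multiple edges; loops are allowed in general. $\mathrm{Hom}(G,H)$ is the set of graph homomorphisms, i.e. maps $\phi:V(G)\to V(H)$ with $\phi(u)\phi(v)\in E(H)$ whenever $uv\in E(G)$. Fix a field $\mathbf{k}$. For $e\in E(G)$ let $G[e]$ be the subgraph consisting only of $e$ and its endpoint(s). Put $R_{G\to H}=\mathbf{k}[r_\phi : \phi\in\mathrm{Hom}(G,H)]$ and $S_{G\to H}=\mathbf{k}[s_\psi : e\in E(G),\ \psi\in \mathrm{Hom}(G[e],H)]$. The edge separator map $\Phi_{G\to H}:R_{G\to H}\to S_{G\to H}$ is the $\mathbf{k}$-algebra map with $\Phi(r_\phi)=\prod_{e\in E(G)} s_{\phi|_e}$, and the ideal of graph homomorphisms is $I_{G\to H}=\ker\Phi_{G\to H}$. $\Lambda$ is the graph with two vertices joined by an edge and with a loop at exactly one of the two vertices. Elements of $\mathrm{Hom}(G,\Lambda)$ correspond bijectively to independent sets $S$ of $G$ ($S$ is the preimage of the unlooped vertex); the corresponding variable of $R_{G\to\Lambda}$ is written $r_S$. For $G$ bipartite with parts $V_1,V_2$, write $r_{S\cap V_1,\,S\cap V_2}$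 for $r_S$.
   Formalization: The graph G is additionally assumed to be nonempty and without isolated vertices; otherwise the ideal contains a nonzero element of degree at most 1 (r_∅ − r_{v} for v isolated, or r − 1 for the empty graph) and the quadratic binomials cannot form a Gröbner basis. *)

theory Defs
  imports "HOL-Algebra.RingHom" "HOL-Library.Poly_Mapping" "HOL-Library.FuncSet"
begin

section \<open>Graphs and homomorphisms\<close>

text \<open>An edge is the set of its endpoints, so a loop at \<open>u\<close> is the singleton \<open>{u} = {u, u}\<close>.\<close>

record 'a ugraph =
  verts :: "'a set"
  edges :: "'a set set"

definition finite_graph :: "'a ugraph \<Rightarrow> bool" where
  "finite_graph G \<longleftrightarrow> finite (verts G) \<and>
     (\<forall>e\<in>edges G. \<exists>u\<in>verts G. \<exists>v\<in>verts G. e = {u, v})"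

definition edge_subgraph :: "'a set \<Rightarrow> 'a ugraph" where
  "edge_subgraph e = \<lparr>verts = e, edges = {e}\<rparr>"

text \<open>Homomorphisms are extensional functions, so that equal maps \<open>V(G) \<rightarrow> V(H)\<close> are equal in HOL.\<close>

definition Hom :: "'a ugraph \<Rightarrow> 'b ugraph \<Rightarrow> ('a \<Rightarrow> 'b) set" where
  "Hom G H = {\<phi> \<in> verts G \<rightarrow>\<^sub>E verts H.
     \<forall>u v. {u, v} \<in> edges G \<longrightarrow> {\<phi> u, \<phi> v} \<in> edges H}"

definition bipartite :: "'a ugraph \<Rightarrow> 'a set \<Rightarrow> 'a set \<Rightarrow> bool" where
  "bipartite G V1 V2 \<longleftrightarrow> V1 \<union> V2 = verts G \<and> V1 \<inter> V2 = {} \<and>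
     (\<forall>e\<in>edges G. \<exists>u\<in>V1. \<exists>v\<in>V2. e = {u, v})"

definition independent :: "'a ugraph \<Rightarrow> 'a set \<Rightarrow> bool" where
  "independent G S \<longleftrightarrow> S \<subseteq> verts G \<and> (\<forall>u\<in>S. \<forall>v\<in>S. {u, v} \<notin> edges G)"

datatype lam = Unlooped | Looped

definition Lambda :: "lam ugraph" where
  "Lambda = \<lparr>verts = {Unlooped, Looped}, edges = {{Unlooped, Looped}, {Looped}}\<rparr>"

definition indep_hom :: "'a ugraph \<Rightarrow> 'a set \<Rightarrow> 'a \<Rightarrow> lam" where
  "indep_hom G S = (\<lambda>v\<in>verts G. if v \<in> S then Unlooped else Looped)"

lemma indep_hom_bij:
  assumes "finite_graph G"
  shows "bij_betw (indep_hom G) {S. independent G S} (Hom G Lambda)"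
proof (rule bij_betwI[where g = "\<lambda>\<phi>. {v \<in> verts G. \<phi> v = Unlooped}"])
  have sub: "u \<in> verts G \<and> v \<in> verts G" if "{u, v} \<in> edges G" for u v
    using assms that unfolding finite_graph_def by (metis doubleton_eq_iff)
  show "indep_hom G \<in> {S. independent G S} \<rightarrow> Hom G Lambda"
  proof
    fix S assume "S \<in> {S. independent G S}"
    then have S: "{u, v} \<notin> edges G" if "u \<in> S" "v \<in> S" for u v
      using that by (simp add: independent_def)
    have "{indep_hom G S u, indep_hom G S v} \<in> edges Lambda" if "{u, v} \<in> edges G" for u v
      using sub[OF that] S[of u v] that
      by (cases "u \<in> S"; cases "v \<in> S") (auto simp: indep_hom_def Lambda_def insert_commute)
    moreover have "indep_hom G S \<in> verts G \<rightarrow>\<^sub>E verts Lambda"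
      by (auto simp: indep_hom_def Lambda_def)
    ultimately show "indep_hom G S \<in> Hom G Lambda" by (simp add: Hom_def)
  qed
  show "(\<lambda>\<phi>. {v \<in> verts G. \<phi> v = Unlooped}) \<in> Hom G Lambda \<rightarrow> {S. independent G S}"
    by (force simp: Hom_def Lambda_def independent_def)
  show "{v \<in> verts G. indep_hom G S v = Unlooped} = S" if "S \<in> {S. independent G S}" for S
    using that by (auto simp: indep_hom_def independent_def)
  show "indep_hom G {v \<in> verts G. \<phi> v = Unlooped} = \<phi>" if "\<phi> \<in> Hom G Lambda" for \<phi>
  proof
    fix v show "indep_hom G {v \<in> verts G. \<phi> v = Unlooped} v = \<phi> v"
      using that
      by (cases "\<phi> v") (auto simp: indep_hom_def Hom_def PiE_def extensional_def)
  qed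
qed


section \<open>Polynomial rings and Groebner bases\<close>

text \<open>A monomial is its exponent function \<open>'v \<Rightarrow>\<^sub>0 nat\<close>, and a polynomial is a finitely
  supported function from monomials to coefficients, multiplied by convolution.\<close>

type_synonym ('v, 'k) mvpoly = "('v \<Rightarrow>\<^sub>0 nat) \<Rightarrow>\<^sub>0 'k"

definition monomials :: "'v set \<Rightarrow> ('v \<Rightarrow>\<^sub>0 nat) set" where
  "monomials X = {m. Poly_Mapping.keys m \<subseteq> X}"

definition poly_ring :: "'v set \<Rightarrow> ('v, 'k::comm_ring_1) mvpoly ring" where
  "poly_ring X = \<lparr>carrier = {p. Poly_Mapping.keys p \<subseteq> monomials X},
     monoid.mult = (*), one = 1, zero = 0, add = (+)\<rparr>"

definition mono_poly :: "('v \<Rightarrow>\<^sub>0 nat) \<Rightarrow> ('v, 'k::comm_ring_1) mvpoly" where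
  "mono_poly m = Poly_Mapping.single m 1"

definition var :: "'v \<Rightarrow> ('v, 'k::comm_ring_1) mvpoly" where
  "var v = mono_poly (Poly_Mapping.single v 1)"

text \<open>The algebra map sending each variable \<open>v\<close> to \<open>f v\<close>.\<close>

definition poly_subst :: "('v \<Rightarrow> ('w, 'k) mvpoly) \<Rightarrow> ('v, 'k::comm_ring_1) mvpoly \<Rightarrow> ('w, 'k) mvpoly" where
  "poly_subst f p = (\<Sum>m\<in>Poly_Mapping.keys p. Poly_Mapping.single 0 (Poly_Mapping.lookup p m) *
     (\<Prod>v\<in>Poly_Mapping.keys m. f v ^ Poly_Mapping.lookup m v))"

lemma poly_subst_var: "poly_subst f (var v) = f v"
  by (simp add: poly_subst_def var_def mono_poly_def)

text \<open>\<open>(m, m') \<in> ord\<close> means \<open>m \<le> m'\<close>.\<close>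

definition monomial_order :: "'v set \<Rightarrow> ('v \<Rightarrow>\<^sub>0 nat) rel \<Rightarrow> bool" where
  "monomial_order X ord \<longleftrightarrow> linear_order_on (monomials X) ord \<and>
     (\<forall>m\<in>monomials X. (0, m) \<in> ord) \<and>
     (\<forall>(m, m')\<in>ord. \<forall>t\<in>monomials X. (m + t, m' + t) \<in> ord)"

definition lead_monomial :: "('v \<Rightarrow>\<^sub>0 nat) rel \<Rightarrow> ('v, 'k::comm_ring_1) mvpoly \<Rightarrow> 'v \<Rightarrow>\<^sub>0 nat" where
  "lead_monomial ord p =
     (THE m. m \<in> Poly_Mapping.keys p \<and> (\<forall>m'\<in>Poly_Mapping.keys p. (m', m) \<in> ord))"

definition initial_ideal ::
  "'v set \<Rightarrow> ('v \<Rightarrow>\<^sub>0 nat) rel \<Rightarrow> ('v, 'k::comm_ring_1) mvpoly set \<Rightarrow> ('v, 'k) mvpoly set" where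
  "initial_ideal X ord F = Idl\<^bsub>poly_ring X\<^esub> {mono_poly (lead_monomial ord f) | f. f \<in> F \<and> f \<noteq> 0}"

text \<open>\<open>B\<close> is a Groebner basis of the ideal \<open>I\<close> of \<open>poly_ring X\<close> with respect to \<open>ord\<close>.\<close>

definition groebner_basis ::
  "'v set \<Rightarrow> ('v \<Rightarrow>\<^sub>0 nat) rel \<Rightarrow> ('v, 'k::comm_ring_1) mvpoly set \<Rightarrow> ('v, 'k) mvpoly set \<Rightarrow> bool" where
  "groebner_basis X ord I B \<longleftrightarrow> ideal I (poly_ring X) \<and> finite B \<and> B \<subseteq> I \<and>
     initial_ideal X ord B = initial_ideal X ord I"

definition mono_degree :: "('v \<Rightarrow>\<^sub>0 nat) \<Rightarrow> nat" where
  "mono_degree m = (\<Sum>v\<in>Poly_Mapping.keys m. Poly_Mapping.lookup m v)"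

definition quadratic :: "('v, 'k::comm_ring_1) mvpoly \<Rightarrow> bool" where
  "quadratic p \<longleftrightarrow> p \<noteq> 0 \<and> (\<forall>m\<in>Poly_Mapping.keys p. mono_degree m = 2)"

definition squarefree_mono :: "('v \<Rightarrow>\<^sub>0 nat) \<Rightarrow> bool" where
  "squarefree_mono m \<longleftrightarrow> (\<forall>v. Poly_Mapping.lookup m v \<le> 1)"


section \<open>The ideal of graph homomorphisms\<close>

definition R_ring :: "'a ugraph \<Rightarrow> 'b ugraph \<Rightarrow> ('a \<Rightarrow> 'b, 'k::field) mvpoly ring" where
  "R_ring G H = poly_ring (Hom G H)"

text \<open>The variable \<open>s\<^sub>\<psi>\<close> with \<open>\<psi> \<in> Hom(G[e], H)\<close> is indexed by the pair \<open>(e, \<psi>)\<close>.\<close>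

definition S_ring :: "'a ugraph \<Rightarrow> 'b ugraph \<Rightarrow> ('a set \<times> ('a \<Rightarrow> 'b), 'k::field) mvpoly ring" where
  "S_ring G H = poly_ring (SIGMA e:edges G. Hom (edge_subgraph e) H)"

definition edge_separator_map :: "'a ugraph \<Rightarrow> 'b ugraph \<Rightarrow>
    ('a \<Rightarrow> 'b, 'k::field) mvpoly \<Rightarrow> ('a set \<times> ('a \<Rightarrow> 'b), 'k) mvpoly" where
  "edge_separator_map G H = poly_subst (\<lambda>\<phi>. \<Prod>e\<in>edges G. var (e, restrict \<phi> e))"

definition hom_ideal :: "'a ugraph \<Rightarrow> 'b ugraph \<Rightarrow> ('a \<Rightarrow> 'b, 'k::field) mvpoly set" where
  "hom_ideal G H = a_kernel (R_ring G H) (S_ring G H) (edge_separator_map G H)"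

definition indep_var :: "'a ugraph \<Rightarrow> 'a set \<Rightarrow> 'a set \<Rightarrow> ('a \<Rightarrow> lam, 'k::field) mvpoly" where
  "indep_var G A B = var (indep_hom G (A \<union> B))"

definition lattice_binomials ::
  "'a ugraph \<Rightarrow> 'a set \<Rightarrow> 'a set \<Rightarrow> ('a \<Rightarrow> lam, 'k::field) mvpoly set" where
  "lattice_binomials G V1 V2 =
     {indep_var G A B * indep_var G C D
        - indep_var G (A \<inter> C) (B \<union> D) * indep_var G (A \<union> C) (B \<inter> D) | A B C D.
      A \<subseteq> V1 \<and> C \<subseteq> V1 \<and> B \<subseteq> V2 \<and> D \<subseteq> V2 \<and>
      independent G (A \<union> B) \<and> independent G (C \<union> D)}"

text \<open>The graph is nonempty and has no isolated vertices. The main theorem fails without this: for an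
  isolated vertex \<open>v\<close> the difference of the variables for the independent sets \<open>{}\<close> and \<open>{v}\<close> is in
  the kernel, and for the empty graph so is the difference of the only variable and \<open>1\<close>; a nonzero
  polynomial of degree at most 1 has its initial term outside every ideal generated by quadratic
  monomials.\<close>

definition covered_by_edges :: "'a ugraph \<Rightarrow> bool" where
  "covered_by_edges G \<longleftrightarrow> verts G \<noteq> {} \<and> (\<forall>v\<in>verts G. \<exists>e\<in>edges G. v \<in> e)"

end

theory Submission
  imports Defs
begin

text \<open>Sending \<open>A \<union> B\<close> to \<open>A \<union> (V2 - B)\<close> identifies the independent sets with the subsets of the vertex
  set closed under passing from \<open>V1\<close> to \<open>V2\<close> along edges. This is a distributive lattice, and the
  binomials become the Hibi relations \<open>r\<^sub>U r\<^sub>W - r\<^sub>U\<^sub>\<inter>\<^sub>W r\<^sub>U\<^sub>\<union>\<^sub>W\<close>. For the weight \<open>|V|\<^sup>2 - |U|\<^sup>2\<close> their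
  leading term is the product of the two incomparable variables, so every monomial reduces, with
  decreasing weight and unchanged image under \<open>\<Phi>\<close>, to a standard one, whose support is a chain.
  A standard monomial is determined by its image: the image gives the degree and, for each vertex,
  the number of factors avoiding it, hence the least factor of the chain, which can be split off.
  So standard monomials are least in their fibres and lead no element of the kernel of \<open>\<Phi>\<close>.\<close>

subsection \<open>Additive functions of monomials\<close>

text \<open>The additive extension of \<open>g\<close> from variables to monomials. Repeated
  addition in place of scalar multiplication lets one notion serve both for numbers (degree, weight,
  counts) and for exponents of image monomials.\<close>

definition mono_sum :: "('v \<Rightarrow> 'b::comm_monoid_add) \<Rightarrow> ('v \<Rightarrow>\<^sub>0 nat) \<Rightarrow> 'b" where
  "mono_sum g m = (\<Sum>v\<in>Poly_Mapping.keys m. \<Sum>i<Poly_Mapping.lookup m v. g v)"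

text \<open>Indices outside the support contribute nothing, so \<open>m\<close>, \<open>n\<close>
  and \<open>m + n\<close> can share one index set, which turns additivity into a termwise
  identity.\<close>

lemma mono_sum_superset:
  assumes "finite A" "Poly_Mapping.keys m \<subseteq> A"
  shows "mono_sum g m = (\<Sum>v\<in>A. \<Sum>i<Poly_Mapping.lookup m v. g v)"
  unfolding mono_sum_def
  by (rule sum.mono_neutral_left) (use assms in \<open>auto simp: in_keys_iff\<close>)

lemma mono_sum_zero [simp]: "mono_sum g 0 = 0"
  by (simp add: mono_sum_def)

lemma mono_sum_single [simp]: "mono_sum g (Poly_Mapping.single v (Suc 0)) = g v"
  by (simp add: mono_sum_def)

lemma sum_lessThan_add_const:
  "(\<Sum>i<a + b. c) = (\<Sum>i<a. c) + (\<Sum>i<b. c)" for c :: "'b::comm_monoid_add" and a b :: nat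
  by (induction b) (simp_all add: add.assoc)

lemma mono_sum_add: "mono_sum g (m + n) = mono_sum g m + mono_sum g n"
proof -
  define A where "A = Poly_Mapping.keys m \<union> Poly_Mapping.keys n"
  have A: "finite A" "Poly_Mapping.keys m \<subseteq> A" "Poly_Mapping.keys n \<subseteq> A"
    "Poly_Mapping.keys (m + n) \<subseteq> A"
    using keys_add[of m n] by (auto simp: A_def)
  show ?thesis
    by (simp add: mono_sum_superset[OF A(1,2)] mono_sum_superset[OF A(1,3)]
        mono_sum_superset[OF A(1,4)] lookup_add sum_lessThan_add_const sum.distrib)
qed

lemma mono_sum_sum: "mono_sum g (\<Sum>a\<in>A. m a) = (\<Sum>a\<in>A. mono_sum g (m a))"
  by (induction A rule: infinite_finite_induct) (simp_all add: mono_sum_add)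

text \<open>Used to pull an additive statistic \<open>h\<close> of the image monomial back to the
  source: equal images force equal values of the pulled-back statistic.\<close>

lemma mono_sum_mono_sum: "mono_sum h (mono_sum g m) = mono_sum (\<lambda>v. mono_sum h (g v)) m"
  unfolding mono_sum_def[of g] mono_sum_def[of "\<lambda>v. mono_sum h (g v)"] mono_sum_sum ..

lemma mono_sum_nat: "mono_sum f m = (\<Sum>v\<in>Poly_Mapping.keys m. Poly_Mapping.lookup m v * f v)"
  for f :: "'v \<Rightarrow> nat"
  by (simp add: mono_sum_def)

lemma mono_degree_eq_mono_sum: "mono_degree m = mono_sum (\<lambda>_. 1) m"
  by (simp add: mono_degree_def mono_sum_nat)

lemma mono_sum_nat_eq_0_iff: "mono_sum f m = 0 \<longleftrightarrow> (\<forall>v\<in>Poly_Mapping.keys m. f v = 0)"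
  for f :: "'v \<Rightarrow> nat"
  by (auto simp: mono_sum_nat in_keys_iff)

lemma zero_mem_monomials [simp]: "0 \<in> monomials X"
  by (simp add: monomials_def)

lemma monomials_add: "m \<in> monomials X \<Longrightarrow> n \<in> monomials X \<Longrightarrow> m + n \<in> monomials X"
  using keys_add[of m n] by (auto simp: monomials_def)

lemma monomials_addD: "m + n \<in> monomials X \<Longrightarrow> m \<in> monomials X \<and> n \<in> monomials X"
  for m n :: "'v \<Rightarrow>\<^sub>0 nat"
  by (auto simp: monomials_def in_keys_iff lookup_add subset_iff)

lemma single_mem_monomials: "v \<in> X \<Longrightarrow> Poly_Mapping.single v n \<in> monomials X"
  by (auto simp: monomials_def)

lemma monomial_decomp:
  fixes m :: "'v \<Rightarrow>\<^sub>0 nat"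
  assumes "v \<in> Poly_Mapping.keys m"
  obtains n where "m = n + Poly_Mapping.single v 1"
proof -
  have "m = (m - Poly_Mapping.single v 1) + Poly_Mapping.single v 1"
    using assms by (intro poly_mapping_eqI)
      (auto simp: lookup_add lookup_minus lookup_single when_def in_keys_iff)
  then show ?thesis using that by blast
qed

lemma keys_add_monomial: "Poly_Mapping.keys (m + n) = Poly_Mapping.keys m \<union> Poly_Mapping.keys n"
  for m n :: "'v \<Rightarrow>\<^sub>0 nat"
  by (auto simp: in_keys_iff lookup_add)

subsection \<open>Polynomial rings and monomial substitutions\<close>

lemma carrier_poly_ring: "p \<in> carrier (poly_ring X) \<longleftrightarrow> Poly_Mapping.keys p \<subseteq> monomials X"
  by (simp add: poly_ring_def)

lemma cring_poly_ring: "cring (poly_ring X :: ('v, 'k::comm_ring_1) mvpoly ring)"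
proof (rule cringI)
  show "abelian_group (poly_ring X :: ('v, 'k) mvpoly ring)"
  proof (rule abelian_groupI)
    show "x \<oplus>\<^bsub>poly_ring X\<^esub> y \<in> carrier (poly_ring X)"
      if "x \<in> carrier (poly_ring X)" "y \<in> carrier (poly_ring X)" for x y :: "('v, 'k) mvpoly"
      using that keys_add[of x y] by (auto simp: poly_ring_def)
    show "\<exists>y\<in>carrier (poly_ring X). y \<oplus>\<^bsub>poly_ring X\<^esub> x = \<zero>\<^bsub>poly_ring X\<^esub>"
      if "x \<in> carrier (poly_ring X)" for x :: "('v, 'k) mvpoly"
      using that by (intro bexI[of _ "- x"]) (auto simp: poly_ring_def in_keys_iff)
  qed (auto simp: poly_ring_def algebra_simps)
  show "comm_monoid (poly_ring X :: ('v, 'k) mvpoly ring)"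
  proof (rule comm_monoidI)
    show "x \<otimes>\<^bsub>poly_ring X\<^esub> y \<in> carrier (poly_ring X)"
      if "x \<in> carrier (poly_ring X)" "y \<in> carrier (poly_ring X)" for x y :: "('v, 'k) mvpoly"
      using that keys_mult[of x y] monomials_add by (fastforce simp: poly_ring_def)
  qed (auto simp: poly_ring_def algebra_simps)
qed (auto simp: poly_ring_def algebra_simps)

lemma mono_poly_mult: "mono_poly m * mono_poly n = mono_poly (m + n)"
  by (simp add: mono_poly_def mult_single)

lemma mono_poly_power: "mono_poly m ^ n = mono_poly (\<Sum>i<n. m)"
  by (induction n) (simp_all add: mono_poly_mult add.commute, simp add: mono_poly_def)

lemma mono_poly_prod: "(\<Prod>a\<in>A. mono_poly (m a)) = mono_poly (\<Sum>a\<in>A. m a)"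
  by (induction A rule: infinite_finite_induct) (simp_all add: mono_poly_mult, simp_all add: mono_poly_def)

lemma mono_poly_mem_carrier: "m \<in> monomials X \<Longrightarrow> mono_poly m \<in> carrier (poly_ring X)"
  by (auto simp: carrier_poly_ring mono_poly_def)

lemma keys_mono_poly [simp]: "Poly_Mapping.keys (mono_poly m :: ('v, 'k::comm_ring_1) mvpoly) = {m}"
  by (simp add: mono_poly_def)

text \<open>When variables go to monomials, substitution merely moves each coefficient from
  \<open>m\<close> to \<open>mono_sum g m\<close>, so cancellation happens only within a fibre of
  \<open>mono_sum g\<close>.\<close>

lemma poly_subst_mono_poly:
  "poly_subst (\<lambda>v. mono_poly (g v)) p =
    (\<Sum>m\<in>Poly_Mapping.keys p. Poly_Mapping.single (mono_sum g m) (Poly_Mapping.lookup p m))"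
  unfolding poly_subst_def mono_poly_power mono_poly_prod mono_sum_def[symmetric]
  by (simp add: mono_poly_def mult_single)

lemma poly_subst_superset:
  assumes "finite A" "Poly_Mapping.keys p \<subseteq> A"
  shows "poly_subst (\<lambda>v. mono_poly (g v)) p =
    (\<Sum>m\<in>A. Poly_Mapping.single (mono_sum g m) (Poly_Mapping.lookup p m))"
  unfolding poly_subst_mono_poly
  by (rule sum.mono_neutral_left) (use assms in \<open>auto simp: in_keys_iff\<close>)

lemma poly_subst_single:
  "poly_subst (\<lambda>v. mono_poly (g v)) (Poly_Mapping.single m c) = Poly_Mapping.single (mono_sum g m) c"
  by (subst poly_subst_superset[of "{m}"]) auto

lemma poly_subst_add:
  "poly_subst (\<lambda>v. mono_poly (g v)) (p + q) =
    poly_subst (\<lambda>v. mono_poly (g v)) p + poly_subst (\<lambda>v. mono_poly (g v)) q"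
proof -
  define A where "A = Poly_Mapping.keys p \<union> Poly_Mapping.keys q"
  have A: "finite A" "Poly_Mapping.keys p \<subseteq> A" "Poly_Mapping.keys q \<subseteq> A"
    "Poly_Mapping.keys (p + q) \<subseteq> A"
    using keys_add[of p q] by (auto simp: A_def)
  show ?thesis
    by (simp add: poly_subst_superset[OF A(1,2)] poly_subst_superset[OF A(1,3)]
        poly_subst_superset[OF A(1,4)] lookup_add single_add sum.distrib)
qed

lemma poly_subst_zero [simp]: "poly_subst f 0 = 0"
  by (simp add: poly_subst_def)

lemma poly_subst_sum:
  "poly_subst (\<lambda>v. mono_poly (g v)) (\<Sum>a\<in>A. p a) = (\<Sum>a\<in>A. poly_subst (\<lambda>v. mono_poly (g v)) (p a))"
  by (induction A rule: infinite_finite_induct) (simp_all add: poly_subst_add)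

lemma poly_mapping_expansion:
  "p = (\<Sum>m\<in>Poly_Mapping.keys p. Poly_Mapping.single m (Poly_Mapping.lookup p m))"
proof (rule poly_mapping_eqI)
  fix k
  show "Poly_Mapping.lookup p k = Poly_Mapping.lookup (\<Sum>m\<in>Poly_Mapping.keys p. Poly_Mapping.single m (Poly_Mapping.lookup p m)) k"
    by (auto simp: lookup_sum lookup_single when_def sum.delta in_keys_iff)
qed

lemma poly_subst_mult:
  "poly_subst (\<lambda>v. mono_poly (g v)) (p * q) =
    poly_subst (\<lambda>v. mono_poly (g v)) p * poly_subst (\<lambda>v. mono_poly (g v)) q"
proof -
  have "p * q = (\<Sum>m\<in>Poly_Mapping.keys p. \<Sum>n\<in>Poly_Mapping.keys q.
      Poly_Mapping.single (m + n) (Poly_Mapping.lookup p m * Poly_Mapping.lookup q n))"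
    by (subst poly_mapping_expansion[of p], subst poly_mapping_expansion[of q])
      (simp add: sum_product mult_single)
  then show ?thesis
    by (simp add: poly_subst_sum poly_subst_single mono_sum_add
        poly_subst_mono_poly[of g p] poly_subst_mono_poly[of g q] sum_product mult_single)
qed

lemma ideal_kernel_poly_subst:
  fixes g :: "'v \<Rightarrow> 'w \<Rightarrow>\<^sub>0 nat"
  shows "ideal {p \<in> carrier (poly_ring X). poly_subst (\<lambda>v. mono_poly (g v)) p = (0 :: ('w, 'k::comm_ring_1) mvpoly)}
     (poly_ring X)"
proof -
  \<comment> \<open>The kernel as a set does not depend on which target variables are allowed;
    allowing all of them makes every image an element of the target ring.\<close>
  let ?S = "poly_ring UNIV :: ('w, 'k) mvpoly ring"
  have "ring_hom_ring (poly_ring X) ?S (poly_subst (\<lambda>v. mono_poly (g v)))"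
  proof (rule ring_hom_ringI)
    show "poly_subst (\<lambda>v. mono_poly (g v)) \<one>\<^bsub>poly_ring X\<^esub> = \<one>\<^bsub>?S\<^esub>"
      using poly_subst_single[of g 0 "1 :: 'k"] by (simp add: poly_ring_def)
  qed (simp_all add: cring.axioms(1) cring_poly_ring, simp_all add: poly_ring_def monomials_def poly_subst_add poly_subst_mult)
  then have "ideal (a_kernel (poly_ring X) ?S (poly_subst (\<lambda>v. mono_poly (g v)))) (poly_ring X)"
    by (rule ring_hom_ring.kernel_is_ideal)
  then show ?thesis
    by (simp add: a_kernel_def' poly_ring_def)
qed

subsection \<open>Weighted monomial orders\<close>

text \<open>In general only a total preorder: elements on which all listed functions agree are
  equivalent. Antisymmetry has to come from a list that separates points.\<close>

fun lex_le :: "('m \<Rightarrow> nat) list \<Rightarrow> 'm \<Rightarrow> 'm \<Rightarrow> bool" where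
  "lex_le [] a b \<longleftrightarrow> True"
| "lex_le (f # fs) a b \<longleftrightarrow> f a < f b \<or> f a = f b \<and> lex_le fs a b"

lemma lex_le_refl: "lex_le fs a a"
  by (induction fs) auto

lemma lex_le_total: "lex_le fs a b \<or> lex_le fs b a"
  by (induction fs) auto

lemma lex_le_trans: "lex_le fs a b \<Longrightarrow> lex_le fs b c \<Longrightarrow> lex_le fs a c"
  by (induction fs) auto

lemma lex_le_antisym: "lex_le fs a b \<Longrightarrow> lex_le fs b a \<Longrightarrow> f \<in> set fs \<Longrightarrow> f a = f b"
  by (induction fs) auto

lemma lex_le_add:
  fixes a b c :: "'m::plus"
  assumes "\<And>f x y. f \<in> set fs \<Longrightarrow> f (x + y) = f x + f y" "lex_le fs a b"
  shows "lex_le fs (a + c) (b + c)"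
  using assms
proof (induction fs)
  case (Cons f fs)
  then have "f (a + c) = f a + f c" "f (b + c) = f b + f c" "lex_le fs a b \<Longrightarrow> lex_le fs (a + c) (b + c)"
    by simp_all
  with Cons.prems(2) show ?case by auto
qed simp

lemma lex_le_zero:
  assumes "\<And>f. f \<in> set fs \<Longrightarrow> f z = 0"
  shows "lex_le fs z a"
  using assms
proof (induction fs)
  case (Cons f fs)
  then have "f z = 0" "lex_le fs z a" by simp_all
  then show ?case by auto
qed simp

text \<open>Ties in the weight are broken lexicographically along an enumeration of the variables.\<close>

lemma weight_monomial_order:
  fixes w :: "'v \<Rightarrow> nat"
  assumes "finite X"
  obtains ord where "monomial_order X ord"
    and "\<And>m n. m \<in> monomials X \<Longrightarrow> n \<in> monomials X \<Longrightarrow> mono_sum w m < mono_sum w n \<Longrightarrow> (m, n) \<in> ord"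
proof -
  obtain xs where xs: "set xs = X"
    using assms finite_list by blast
  \<comment> \<open>All these functions are additive and vanish at 0, which gives compatibility with
    multiplication and minimality of the monomial 1. The exponents along \<open>xs\<close> separate
    the monomials in \<open>X\<close>.\<close>
  define fs where "fs = mono_sum w # map (\<lambda>v m. Poly_Mapping.lookup m v) xs"
  define ord where "ord = {(m, n). m \<in> monomials X \<and> n \<in> monomials X \<and> lex_le fs m n}"
  have add: "f (x + y) = f x + f y" if "f \<in> set fs" for f x y
    using that by (auto simp: fs_def mono_sum_add lookup_add)
  have zero: "lex_le fs 0 m" for m
    by (rule lex_le_zero) (auto simp: fs_def)
  have "antisym ord"
  proof (rule antisymI)
    fix m n assume mn: "(m, n) \<in> ord" "(n, m) \<in> ord"
    have "Poly_Mapping.lookup m v = Poly_Mapping.lookup n v" for v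
    proof (cases "v \<in> X")
      case True
      then have "(\<lambda>m. Poly_Mapping.lookup m v) \<in> set fs"
        by (auto simp: fs_def xs)
      with mn show ?thesis
        using lex_le_antisym[of fs m n "\<lambda>m. Poly_Mapping.lookup m v"] by (auto simp: ord_def)
    next
      case False
      with mn have "v \<notin> Poly_Mapping.keys m" "v \<notin> Poly_Mapping.keys n"
        by (auto simp: ord_def monomials_def)
      then show ?thesis by (simp add: in_keys_iff)
    qed
    then show "m = n" by (intro poly_mapping_eqI)
  qed
  moreover have "trans ord"
    by (rule transI) (auto simp: ord_def intro: lex_le_trans)
  moreover have "refl_on (monomials X) ord" "total_on (monomials X) ord" "ord \<subseteq> monomials X \<times> monomials X"
    using lex_le_total[of fs] by (auto simp: ord_def refl_on_def total_on_def lex_le_refl)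
  ultimately have "linear_order_on (monomials X) ord"
    by (simp add: linear_order_on_def partial_order_on_def preorder_on_def)
  then have "monomial_order X ord"
    unfolding monomial_order_def
    using lex_le_add[OF add] zero
    by (auto simp: ord_def monomials_add)
  moreover have "(m, n) \<in> ord"
    if "m \<in> monomials X" "n \<in> monomials X" "mono_sum w m < mono_sum w n" for m n
    using that by (simp add: ord_def fs_def)
  ultimately show ?thesis using that by blast
qed

section \<open>Leading monomials\<close>

lemma linear_order_on_finite_max:
  assumes "linear_order_on A r" "finite S" "S \<noteq> {}" "S \<subseteq> A"
  shows "\<exists>m\<in>S. \<forall>x\<in>S. (x, m) \<in> r"
  using assms(2-4)
proof (induction S rule: finite_ne_induct)
  case (singleton x)
  with assms(1) show ?case
    by (auto simp: order_on_defs refl_on_def)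
next
  case (insert x S)
  then obtain m where m: "m \<in> S" "\<forall>y\<in>S. (y, m) \<in> r" by auto
  have tr: "trans r" and rx: "(x, x) \<in> r" and mx: "(x, m) \<in> r \<or> (m, x) \<in> r"
    using assms(1) insert m(1) by (auto simp: order_on_defs refl_on_def total_on_def)
  from mx show ?case
  proof
    assume "(x, m) \<in> r"
    with m show ?thesis by auto
  next
    assume "(m, x) \<in> r"
    with m(2) tr have "\<forall>y\<in>S. (y, x) \<in> r" by (blast dest: transD)
    with rx show ?thesis by auto
  qed
qed

lemma lead_monomialI:
  assumes "monomial_order X ord" "m \<in> Poly_Mapping.keys p" "\<And>n. n \<in> Poly_Mapping.keys p \<Longrightarrow> (n, m) \<in> ord"
  shows "lead_monomial ord p = m"
proof -
  have "antisym ord"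
    using assms(1) by (auto simp: monomial_order_def order_on_defs)
  then show ?thesis
    unfolding lead_monomial_def using assms(2,3)
    by (intro the_equality) (auto dest: antisymD)
qed

lemma lead_monomial_max:
  assumes "monomial_order X ord" "p \<in> carrier (poly_ring X)" "p \<noteq> 0"
  shows "lead_monomial ord p \<in> Poly_Mapping.keys p"
    and "n \<in> Poly_Mapping.keys p \<Longrightarrow> (n, lead_monomial ord p) \<in> ord"
proof -
  have "Poly_Mapping.keys p \<noteq> {}"
    using assms(3) by (metis keys_eq_empty)
  then obtain m where m: "m \<in> Poly_Mapping.keys p" "\<And>n. n \<in> Poly_Mapping.keys p \<Longrightarrow> (n, m) \<in> ord"
    using linear_order_on_finite_max[of "monomials X" ord "Poly_Mapping.keys p"] assms
    by (auto simp: monomial_order_def carrier_poly_ring)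
  with lead_monomialI[OF assms(1) m]
  show "lead_monomial ord p \<in> Poly_Mapping.keys p"
    "n \<in> Poly_Mapping.keys p \<Longrightarrow> (n, lead_monomial ord p) \<in> ord" by auto
qed

subsection \<open>Straightening relations\<close>

lemma mono_poly_mult_mem_ideal:
  assumes "ideal I (poly_ring X)" "mono_poly m \<in> I" "n \<in> monomials X"
  shows "mono_poly (n + m) \<in> I"
  using ideal.I_l_closed[OF assms(1,2) mono_poly_mem_carrier[OF assms(3)]]
  by (simp add: poly_ring_def mono_poly_mult)

text \<open>The lattice enters only through this data: \<open>inc\<close> marks the products to be
  rewritten, rewriting to meet times join keeps the image under \<open>g\<close> and lowers the
  weight \<open>w\<close>, and \<open>standard_unique\<close> says that monomials with no marked
  pair are separated by their images.\<close>

locale straightening =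
  fixes X :: "'v set" and g :: "'v \<Rightarrow> 'w \<Rightarrow>\<^sub>0 nat"
    and inc :: "'v \<Rightarrow> 'v \<Rightarrow> bool" and meet join :: "'v \<Rightarrow> 'v \<Rightarrow> 'v" and w :: "'v \<Rightarrow> nat"
  assumes finite_X: "finite X"
    and inc_neq: "inc a b \<Longrightarrow> a \<noteq> b"
    and meet_mem: "a \<in> X \<Longrightarrow> b \<in> X \<Longrightarrow> meet a b \<in> X"
    and join_mem: "a \<in> X \<Longrightarrow> b \<in> X \<Longrightarrow> join a b \<in> X"
    and image_eq: "a \<in> X \<Longrightarrow> b \<in> X \<Longrightarrow> g a + g b = g (meet a b) + g (join a b)"
    and weight_less: "a \<in> X \<Longrightarrow> b \<in> X \<Longrightarrow> inc a b \<Longrightarrow> w (meet a b) + w (join a b) < w a + w b"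
    and standard_unique: "m \<in> monomials X \<Longrightarrow> n \<in> monomials X \<Longrightarrow>
      (\<And>a b. a \<in> Poly_Mapping.keys m \<Longrightarrow> b \<in> Poly_Mapping.keys m \<Longrightarrow> \<not> inc a b) \<Longrightarrow>
      (\<And>a b. a \<in> Poly_Mapping.keys n \<Longrightarrow> b \<in> Poly_Mapping.keys n \<Longrightarrow> \<not> inc a b) \<Longrightarrow>
      mono_sum g m = mono_sum g n \<Longrightarrow> m = n"
begin

definition relations :: "('v, 'k::comm_ring_1) mvpoly set" where
  "relations = {var a * var b - var (meet a b) * var (join a b) | a b. a \<in> X \<and> b \<in> X \<and> inc a b}"

definition toric_ideal :: "('v, 'k::comm_ring_1) mvpoly set" where
  "toric_ideal = {p \<in> carrier (poly_ring X). poly_subst (\<lambda>v. mono_poly (g v)) p = 0}"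

definition standard :: "('v \<Rightarrow>\<^sub>0 nat) \<Rightarrow> bool" where
  "standard m \<longleftrightarrow> (\<forall>a\<in>Poly_Mapping.keys m. \<forall>b\<in>Poly_Mapping.keys m. \<not> inc a b)"

lemma nonstandard_decomp:
  assumes "\<not> standard m"
  obtains t a b where "m = t + (Poly_Mapping.single a 1 + Poly_Mapping.single b 1)" "inc a b"
proof -
  obtain a b where ab: "a \<in> Poly_Mapping.keys m" "b \<in> Poly_Mapping.keys m" "inc a b"
    using assms by (auto simp: standard_def)
  obtain m1 where m1: "m = m1 + Poly_Mapping.single a 1"
    using ab(1) by (rule monomial_decomp)
  \<comment> \<open>As \<open>a\<close> and \<open>b\<close> differ, \<open>b\<close> survives the
    removal of one factor \<open>a\<close>.\<close>
  have "b \<in> Poly_Mapping.keys m1"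
    using ab inc_neq by (auto simp: m1 keys_add_monomial)
  then obtain t where "m1 = t + Poly_Mapping.single b 1"
    by (rule monomial_decomp)
  with m1 ab(3) that show ?thesis by (simp add: ac_simps)
qed

text \<open>Rewriting a marked pair keeps the image and strictly lowers the weight, so it
  terminates. The final disjunction records that a proper reduction ends strictly lighter, hence
  lower in the monomial order.\<close>

lemma standard_form:
  assumes "m \<in> monomials X"
  shows "\<exists>n\<in>monomials X. standard n \<and> mono_sum g n = mono_sum g m \<and> (n = m \<or> mono_sum w n < mono_sum w m)"
  using assms
proof (induction "mono_sum w m" arbitrary: m rule: less_induct)
  case less
  show ?case
  proof (cases "standard m")
    case True
    with less.prems show ?thesis by blast
  next
    case False
    then obtain t a b where m: "m = t + (Poly_Mapping.single a 1 + Poly_Mapping.single b 1)" and ab: "inc a b"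
      by (rule nonstandard_decomp)
    have t: "t \<in> monomials X" and aX: "a \<in> X" and bX: "b \<in> X"
      using less.prems by (auto simp: m monomials_def keys_add_monomial)
    define m' where "m' = t + (Poly_Mapping.single (meet a b) 1 + Poly_Mapping.single (join a b) 1)"
    have "m' \<in> monomials X"
      unfolding m'_def using t aX bX
      by (intro monomials_add single_mem_monomials meet_mem join_mem)
    moreover have "mono_sum w m' < mono_sum w m"
      using weight_less[OF aX bX ab] by (simp add: m m'_def mono_sum_add)
    moreover have "mono_sum g m' = mono_sum g m"
      using image_eq[OF aX bX] by (simp add: m m'_def mono_sum_add)
    ultimately show ?thesis
      using less.hyps[of m'] by fastforce
  qed
qed

lemma relation_eq:
  "var a * var b - var (meet a b) * var (join a b) =
    mono_poly (Poly_Mapping.single a 1 + Poly_Mapping.single b 1)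
    - mono_poly (Poly_Mapping.single (meet a b) 1 + Poly_Mapping.single (join a b) 1)"
  by (simp add: var_def mono_poly_mult)

text \<open>The two monomials have different weights, so they are distinct and neither term cancels,
  in any characteristic.\<close>

lemma keys_relation:
  assumes "a \<in> X" "b \<in> X" "inc a b"
  shows "Poly_Mapping.keys (var a * var b - var (meet a b) * var (join a b) :: ('v, 'k::comm_ring_1) mvpoly)
    = {Poly_Mapping.single a 1 + Poly_Mapping.single b 1,
       Poly_Mapping.single (meet a b) 1 + Poly_Mapping.single (join a b) 1}"
proof -
  have "mono_sum w (Poly_Mapping.single a 1 + Poly_Mapping.single b 1) \<noteq>
      mono_sum w (Poly_Mapping.single (meet a b) 1 + Poly_Mapping.single (join a b) 1)"
    using weight_less[OF assms] by (simp add: mono_sum_add)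
  then have "Poly_Mapping.single a 1 + Poly_Mapping.single b 1 \<noteq>
      Poly_Mapping.single (meet a b) 1 + Poly_Mapping.single (join a b) (1 :: nat)" by metis
  then show ?thesis
    unfolding relation_eq by (auto simp: in_keys_iff lookup_minus mono_poly_def lookup_single when_def split: if_splits)
qed

lemma relations_subset: "relations \<subseteq> toric_ideal"
proof
  fix f :: "('v, 'k::comm_ring_1) mvpoly" assume "f \<in> relations"
  then obtain a b where f: "f = var a * var b - var (meet a b) * var (join a b)"
    and ab: "a \<in> X" "b \<in> X" "inc a b"
    by (auto simp: relations_def)
  have "f \<in> carrier (poly_ring X)"
    unfolding carrier_poly_ring f keys_relation[OF ab]
    using ab by (auto intro!: monomials_add single_mem_monomials meet_mem join_mem)
  \<comment> \<open>Adding back the subtracted product leaves \<open>var a * var b\<close>, which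
    has the same image as that product by \<open>image_eq\<close>; additivity then cancels
    it.\<close>
  moreover have "poly_subst (\<lambda>v. mono_poly (g v)) (f + var (meet a b) * var (join a b)) =
      poly_subst (\<lambda>v. mono_poly (g v)) (var (meet a b) * var (join a b))"
    using image_eq[OF ab(1,2)]
    by (simp add: f poly_subst_mult poly_subst_var mono_poly_mult)
  then have "poly_subst (\<lambda>v. mono_poly (g v)) f = 0"
    unfolding poly_subst_add by simp
  ultimately show "f \<in> toric_ideal"
    by (simp add: toric_ideal_def)
qed

text \<open>A standard monomial is the least one in its fibre, so its image could not cancel.\<close>

lemma lead_monomial_nonstandard:
  assumes "monomial_order X ord"
    and ord: "\<And>m n. m \<in> monomials X \<Longrightarrow> n \<in> monomials X \<Longrightarrow> mono_sum w m < mono_sum w n \<Longrightarrow> (m, n) \<in> ord"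
    and f: "f \<in> toric_ideal" "f \<noteq> 0"
  shows "\<not> standard (lead_monomial ord f)"
proof
  define m where "m = lead_monomial ord f"
  assume "standard (lead_monomial ord f)"
  then have std: "standard m" by (simp add: m_def)
  have fX: "f \<in> carrier (poly_ring X)"
    using f by (simp add: toric_ideal_def)
  have m: "m \<in> Poly_Mapping.keys f" "\<And>n. n \<in> Poly_Mapping.keys f \<Longrightarrow> (n, m) \<in> ord"
    using lead_monomial_max[OF assms(1) fX f(2)] by (auto simp: m_def)
  have keys: "Poly_Mapping.keys f \<subseteq> monomials X"
    using fX by (simp add: carrier_poly_ring)
  have "n = m" if n: "n \<in> Poly_Mapping.keys f" "mono_sum g n = mono_sum g m" for n
  proof (rule ccontr)
    assume "n \<noteq> m"
    obtain n' where n': "n' \<in> monomials X" "standard n'" "mono_sum g n' = mono_sum g n"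
      "n' = n \<or> mono_sum w n' < mono_sum w n"
      using standard_form[of n] n(1) keys by blast
    \<comment> \<open>Both are standard with the same image. Since \<open>n\<close> is not
      \<open>m\<close>, the reduction from \<open>n\<close> to \<open>m\<close> was proper, so
      \<open>m\<close> lies below \<open>n\<close>, against the maximality of
      \<open>m\<close>.\<close>
    have "n' = m"
      using n' n std m(1) keys by (intro standard_unique) (auto simp: standard_def)
    with n' \<open>n \<noteq> m\<close> have "(m, n) \<in> ord"
      using ord[of m n] n(1) m(1) keys by auto
    moreover have "(n, m) \<in> ord" using m(2) n(1) by blast
    moreover have "antisym ord"
      using assms(1) by (auto simp: monomial_order_def order_on_defs)
    ultimately show False using \<open>n \<noteq> m\<close> by (auto dest: antisymD)
  qed
  \<comment> \<open>No other monomial of \<open>f\<close> lies in the fibre of \<open>m\<close>, so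
    this coefficient of the image is the nonzero coefficient of \<open>m\<close> in
    \<open>f\<close>.\<close>
  then have "Poly_Mapping.lookup (poly_subst (\<lambda>v. mono_poly (g v)) f) (mono_sum g m) =
      (\<Sum>n\<in>Poly_Mapping.keys f. if n = m then Poly_Mapping.lookup f n else 0)"
    unfolding poly_subst_mono_poly lookup_sum
    by (intro sum.cong) (auto simp: lookup_single when_def)
  also have "\<dots> = Poly_Mapping.lookup f m"
    using m(1) by (simp add: sum.delta)
  finally show False
    using f m(1) by (simp add: toric_ideal_def in_keys_iff)
qed

theorem groebner_basis_relations:
  "\<exists>ord. monomial_order X ord \<and> groebner_basis X ord (toric_ideal :: ('v, 'k::comm_ring_1) mvpoly set) relations \<and>
    (\<forall>f\<in>relations :: ('v, 'k) mvpoly set. quadratic f \<and> squarefree_mono (lead_monomial ord f))"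
proof -
  obtain ord where mo: "monomial_order X ord"
    and ord: "\<And>m n. m \<in> monomials X \<Longrightarrow> n \<in> monomials X \<Longrightarrow> mono_sum w m < mono_sum w n \<Longrightarrow> (m, n) \<in> ord"
    using weight_monomial_order[OF finite_X] by blast
  let ?I = "toric_ideal :: ('v, 'k) mvpoly set" and ?B = "relations :: ('v, 'k) mvpoly set"
  interpret P: cring "poly_ring X :: ('v, 'k) mvpoly ring" by (rule cring_poly_ring)
  have id: "ideal ?I (poly_ring X)"
    unfolding toric_ideal_def by (rule ideal_kernel_poly_subst)
  have fin: "finite ?B"
  proof (rule finite_subset)
    show "?B \<subseteq> (\<lambda>(a, b). var a * var b - var (meet a b) * var (join a b)) ` (X \<times> X)"
      by (auto simp: relations_def)
  qed (use finite_X in simp)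
  have lead: "lead_monomial ord (var a * var b - var (meet a b) * var (join a b) :: ('v, 'k) mvpoly)
      = Poly_Mapping.single a 1 + Poly_Mapping.single b 1"
    if ab: "a \<in> X" "b \<in> X" "inc a b" for a b
  proof (rule lead_monomialI[OF mo])
    fix n assume "n \<in> Poly_Mapping.keys (var a * var b - var (meet a b) * var (join a b) :: ('v, 'k) mvpoly)"
    then consider "n = Poly_Mapping.single a 1 + Poly_Mapping.single b 1"
      | "n = Poly_Mapping.single (meet a b) 1 + Poly_Mapping.single (join a b) 1"
      using keys_relation[OF ab, where 'k = 'k] by auto
    then show "(n, Poly_Mapping.single a 1 + Poly_Mapping.single b 1) \<in> ord"
    proof cases
      case 1
      moreover have "Poly_Mapping.single a 1 + Poly_Mapping.single b 1 \<in> monomials X"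
        using ab by (intro monomials_add single_mem_monomials)
      ultimately show ?thesis
        using mo by (auto simp: monomial_order_def order_on_defs refl_on_def)
    next
      case 2
      show ?thesis
        unfolding 2 using ab weight_less[OF ab]
        by (intro ord monomials_add single_mem_monomials meet_mem join_mem) (simp_all add: mono_sum_add)
    qed
  qed (simp add: keys_relation[OF ab])
  have nz: "f \<noteq> 0" if "f \<in> ?B" for f
    using that keys_relation[where 'k = 'k] by (fastforce simp: relations_def)
  define LB :: "('v, 'k) mvpoly set" where "LB = {mono_poly (lead_monomial ord f) | f. f \<in> ?B \<and> f \<noteq> 0}"
  define LI :: "('v, 'k) mvpoly set" where "LI = {mono_poly (lead_monomial ord f) | f. f \<in> ?I \<and> f \<noteq> 0}"
  have lead_mem: "lead_monomial ord f \<in> monomials X" if "f \<in> ?I" "f \<noteq> 0" for f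
    using that lead_monomial_max(1)[OF mo, of f] by (auto simp: toric_ideal_def carrier_poly_ring)
  have LI: "LI \<subseteq> carrier (poly_ring X)"
    using lead_mem mono_poly_mem_carrier by (auto simp: LI_def)
  have sub: "LB \<subseteq> LI"
    using relations_subset by (auto simp: LB_def LI_def)
  with LI have LB: "LB \<subseteq> carrier (poly_ring X)" by blast
  \<comment> \<open>The essential inclusion: a leading monomial of the ideal is nonstandard, hence a
    multiple of some product \<open>a b\<close> with \<open>inc a b\<close>, which is itself the
    leading monomial of a relation.\<close>
  have "LI \<subseteq> Idl\<^bsub>poly_ring X\<^esub> LB"
  proof
    fix p assume "p \<in> LI"
    then obtain f where f: "f \<in> ?I" "f \<noteq> 0" and p: "p = mono_poly (lead_monomial ord f)"
      by (auto simp: LI_def)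
    obtain t a b where tab: "lead_monomial ord f = t + (Poly_Mapping.single a 1 + Poly_Mapping.single b 1)" "inc a b"
      using lead_monomial_nonstandard[OF mo ord f] by (auto elim: nonstandard_decomp)
    have X: "t \<in> monomials X" "a \<in> X" "b \<in> X"
      using lead_mem[OF f] by (auto simp: tab monomials_def keys_add_monomial)
    have rel: "var a * var b - var (meet a b) * var (join a b) \<in> ?B"
      using X tab by (auto simp: relations_def)
    then have "mono_poly (lead_monomial ord (var a * var b - var (meet a b) * var (join a b) :: ('v, 'k) mvpoly)) \<in> LB"
      using nz[OF rel] unfolding LB_def by blast
    then have "mono_poly (Poly_Mapping.single a 1 + Poly_Mapping.single b 1) \<in> Idl\<^bsub>poly_ring X\<^esub> LB"
      using lead[OF X(2,3) tab(2)] P.genideal_self[OF LB] by auto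
    then show "p \<in> Idl\<^bsub>poly_ring X\<^esub> LB"
      unfolding p tab(1) by (rule mono_poly_mult_mem_ideal[OF P.genideal_ideal[OF LB] _ X(1)])
  qed
  then have "Idl\<^bsub>poly_ring X\<^esub> LI \<subseteq> Idl\<^bsub>poly_ring X\<^esub> LB"
    by (rule P.genideal_minimal[OF P.genideal_ideal[OF LB]])
  moreover have "Idl\<^bsub>poly_ring X\<^esub> LB \<subseteq> Idl\<^bsub>poly_ring X\<^esub> LI"
    using sub P.genideal_self[OF LI] by (intro P.genideal_minimal P.genideal_ideal LI) blast
  ultimately have "groebner_basis X ord ?I ?B"
    using id fin relations_subset
    by (auto simp: groebner_basis_def initial_ideal_def LB_def LI_def)
  moreover have "quadratic f \<and> squarefree_mono (lead_monomial ord f)" if fB: "f \<in> ?B" for f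
  proof -
    obtain a b where f: "f = var a * var b - var (meet a b) * var (join a b)"
      and ab: "a \<in> X" "b \<in> X" "inc a b"
      using fB by (auto simp: relations_def)
    have deg: "mono_degree (Poly_Mapping.single c 1 + Poly_Mapping.single d 1) = 2" for c d :: 'v
      by (simp add: mono_degree_eq_mono_sum mono_sum_add)
    have "quadratic f"
      using nz[OF fB] deg by (auto simp: quadratic_def f keys_relation[OF ab])
    moreover have "squarefree_mono (lead_monomial ord f)"
      using inc_neq[OF ab(3)]
      by (auto simp: f lead[OF ab] squarefree_mono_def lookup_add lookup_single when_def)
    ultimately show ?thesis ..
  qed
  ultimately show ?thesis using mo by blast
qed

end

subsection \<open>Homomorphisms from a bipartite graph to \<open>\<Lambda>\<close>\<close>

locale bipartite_hom =
  fixes G :: "'a ugraph" and V1 V2 :: "'a set"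
  assumes finite_G: "finite_graph G"
    and bip: "bipartite G V1 V2"
    and cov: "covered_by_edges G"
begin

lemma finite_verts: "finite (verts G)"
  using finite_G by (simp add: finite_graph_def)

lemma edges_subset: "e \<in> edges G \<Longrightarrow> e \<subseteq> verts G"
  using finite_G by (auto simp: finite_graph_def)

lemma finite_edges: "finite (edges G)"
  using finite_subset[of "edges G" "Pow (verts G)"] edges_subset finite_verts by blast

lemma verts_eq: "verts G = V1 \<union> V2" and parts_disjoint: "V1 \<inter> V2 = {}"
  using bip by (auto simp: bipartite_def)

lemma edgeE:
  assumes "e \<in> edges G"
  obtains u v where "u \<in> V1" "v \<in> V2" "e = {u, v}"
  using assms bip by (auto simp: bipartite_def)

text \<open>The up-sets of the poset in which \<open>u\<close> lies below \<open>v\<close> for every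
  edge from \<open>u\<close> in \<open>V1\<close> to \<open>v\<close> in \<open>V2\<close>; they are
  stable under union and intersection.\<close>

definition closed :: "'a set \<Rightarrow> bool" where
  "closed U \<longleftrightarrow> U \<subseteq> verts G \<and> (\<forall>u\<in>V1. \<forall>v\<in>V2. {u, v} \<in> edges G \<longrightarrow> u \<in> U \<longrightarrow> v \<in> U)"

text \<open>For the independent set S of \<open>\<phi>\<close> the equivalence treats both parts at
  once: on \<open>V1\<close> it selects S, on \<open>V2\<close> the complement of S. Complementing
  twice is the identity, so \<open>hom_of\<close> below is the inverse on closed sets.\<close>

definition up_set :: "('a \<Rightarrow> lam) \<Rightarrow> 'a set" where
  "up_set \<phi> = {v \<in> verts G. \<phi> v = Unlooped \<longleftrightarrow> v \<in> V1}"

definition hom_of :: "'a set \<Rightarrow> 'a \<Rightarrow> lam" where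
  "hom_of U = indep_hom G (U \<inter> V1 \<union> (V2 - U))"

lemma hom_of_apply:
  "hom_of U v = (if v \<in> verts G then if v \<in> U \<longleftrightarrow> v \<in> V1 then Unlooped else Looped else undefined)"
  using verts_eq parts_disjoint by (auto simp: hom_of_def indep_hom_def)

lemma closed_up_set:
  assumes "\<phi> \<in> Hom G Lambda"
  shows "closed (up_set \<phi>)"
  unfolding closed_def
proof (intro conjI ballI impI)
  fix u v assume uv: "u \<in> V1" "v \<in> V2" "{u, v} \<in> edges G" "u \<in> up_set \<phi>"
  have "{\<phi> u, \<phi> v} \<in> edges Lambda"
    using assms uv(3) unfolding Hom_def by blast
  moreover have "\<phi> u = Unlooped"
    using uv(1,4) by (simp add: up_set_def)
  ultimately have "\<phi> v \<noteq> Unlooped"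
    by (auto simp: Lambda_def)
  then show "v \<in> up_set \<phi>"
    using uv(2) verts_eq parts_disjoint by (auto simp: up_set_def)
qed (auto simp: up_set_def)

lemma closed_of_independent:
  assumes "A \<subseteq> V1" "B \<subseteq> V2" "independent G (A \<union> B)"
  shows "closed (A \<union> (V2 - B))"
  using assms verts_eq parts_disjoint by (auto simp: closed_def independent_def)

lemma independent_of_closed:
  assumes "closed U"
  shows "independent G (U \<inter> V1 \<union> (V2 - U))"
  unfolding independent_def
proof (intro conjI ballI notI)
  fix u v assume uv: "u \<in> U \<inter> V1 \<union> (V2 - U)" "v \<in> U \<inter> V1 \<union> (V2 - U)" "{u, v} \<in> edges G"
  obtain a b where ab: "a \<in> V1" "b \<in> V2" "{u, v} = {a, b}"
    using uv(3) by (rule edgeE)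
  then have "a \<in> U" "b \<notin> U"
    using uv parts_disjoint by (auto simp: doubleton_eq_iff)
  with ab uv(3) assms show False by (auto simp: closed_def)
qed (use verts_eq in auto)

lemma hom_of_mem: "closed U \<Longrightarrow> hom_of U \<in> Hom G Lambda"
  using independent_of_closed indep_hom_bij[OF finite_G] by (auto simp: hom_of_def bij_betw_def)

lemma up_set_hom_of: "U \<subseteq> verts G \<Longrightarrow> up_set (hom_of U) = U"
  by (auto simp: up_set_def hom_of_apply split: if_splits)

lemma hom_of_up_set:
  assumes "\<phi> \<in> Hom G Lambda"
  shows "hom_of (up_set \<phi>) = \<phi>"
proof
  fix v
  show "hom_of (up_set \<phi>) v = \<phi> v"
    using assms by (cases "\<phi> v") (auto simp: hom_of_apply up_set_def Hom_def PiE_def extensional_def)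
qed

lemma up_set_subset: "up_set \<phi> \<subseteq> verts G"
  by (auto simp: up_set_def)

lemma finite_up_set: "finite (up_set \<phi>)"
  using up_set_subset finite_verts by (rule finite_subset)

section \<open>Lattice operations on homomorphisms, their images and weights\<close>

definition hom_meet :: "('a \<Rightarrow> lam) \<Rightarrow> ('a \<Rightarrow> lam) \<Rightarrow> 'a \<Rightarrow> lam" where
  "hom_meet \<phi> \<chi> = hom_of (up_set \<phi> \<inter> up_set \<chi>)"

definition hom_join :: "('a \<Rightarrow> lam) \<Rightarrow> ('a \<Rightarrow> lam) \<Rightarrow> 'a \<Rightarrow> lam" where
  "hom_join \<phi> \<chi> = hom_of (up_set \<phi> \<union> up_set \<chi>)"

definition incomparable :: "('a \<Rightarrow> lam) \<Rightarrow> ('a \<Rightarrow> lam) \<Rightarrow> bool" where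
  "incomparable \<phi> \<chi> \<longleftrightarrow> \<not> up_set \<phi> \<subseteq> up_set \<chi> \<and> \<not> up_set \<chi> \<subseteq> up_set \<phi>"

definition edge_monomial :: "('a \<Rightarrow> lam) \<Rightarrow> ('a set \<times> ('a \<Rightarrow> lam)) \<Rightarrow>\<^sub>0 nat" where
  "edge_monomial \<phi> = (\<Sum>e\<in>edges G. Poly_Mapping.single (e, restrict \<phi> e) 1)"

text \<open>Subtracting from the constant turns the strict increase of the sum of squares into a
  decrease. The truncated subtraction is exact because up-sets lie in
  \<open>verts G\<close>.\<close>

definition weight :: "('a \<Rightarrow> lam) \<Rightarrow> nat" where
  "weight \<phi> = (card (verts G))\<^sup>2 - (card (up_set \<phi>))\<^sup>2"

lemma hom_meet_mem: "\<phi> \<in> Hom G Lambda \<Longrightarrow> \<chi> \<in> Hom G Lambda \<Longrightarrow> hom_meet \<phi> \<chi> \<in> Hom G Lambda"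
  using closed_up_set[of \<phi>] closed_up_set[of \<chi>]
  unfolding hom_meet_def by (intro hom_of_mem) (auto simp: closed_def)

lemma hom_join_mem: "\<phi> \<in> Hom G Lambda \<Longrightarrow> \<chi> \<in> Hom G Lambda \<Longrightarrow> hom_join \<phi> \<chi> \<in> Hom G Lambda"
  using closed_up_set[of \<phi>] closed_up_set[of \<chi>]
  unfolding hom_join_def by (intro hom_of_mem) (auto simp: closed_def)

lemma restrict_hom_of_cong: "U \<inter> e = W \<inter> e \<Longrightarrow> restrict (hom_of U) e = restrict (hom_of W) e"
  by (rule restrict_ext) (auto simp: hom_of_apply)

text \<open>The closed subsets of a single edge form a chain, so along each edge the meet and the join
  restrict to the two given homomorphisms in some order.\<close>

lemma edge_monomial_meet_join:
  assumes "\<phi> \<in> Hom G Lambda" "\<chi> \<in> Hom G Lambda"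
  shows "edge_monomial \<phi> + edge_monomial \<chi> = edge_monomial (hom_meet \<phi> \<chi>) + edge_monomial (hom_join \<phi> \<chi>)"
  unfolding edge_monomial_def sum.distrib[symmetric]
proof (rule sum.cong[OF refl])
  fix e assume e: "e \<in> edges G"
  define U W where "U = up_set \<phi>" and "W = up_set \<chi>"
  obtain u v where uv: "u \<in> V1" "v \<in> V2" "e = {u, v}"
    using e by (rule edgeE)
  have phi: "restrict \<phi> e = restrict (hom_of U) e" and chi: "restrict \<chi> e = restrict (hom_of W) e"
    using assms by (simp_all add: U_def W_def hom_of_up_set)
  have mj: "hom_meet \<phi> \<chi> = hom_of (U \<inter> W)" "hom_join \<phi> \<chi> = hom_of (U \<union> W)"
    by (simp_all add: hom_meet_def hom_join_def U_def W_def)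
  have "u \<in> U \<Longrightarrow> v \<in> U" "u \<in> W \<Longrightarrow> v \<in> W"
    using closed_up_set[OF assms(1)] closed_up_set[OF assms(2)] uv e
    by (auto simp: closed_def U_def W_def)
  then consider "(U \<inter> W) \<inter> e = U \<inter> e" "(U \<union> W) \<inter> e = W \<inter> e"
    | "(U \<inter> W) \<inter> e = W \<inter> e" "(U \<union> W) \<inter> e = U \<inter> e"
    unfolding uv(3) by blast
  then show "Poly_Mapping.single (e, restrict \<phi> e) 1 + Poly_Mapping.single (e, restrict \<chi> e) 1 =
      Poly_Mapping.single (e, restrict (hom_meet \<phi> \<chi>) e) 1 +
      Poly_Mapping.single (e, restrict (hom_join \<phi> \<chi>) e) (1 :: nat)"
  proof cases
    case 1
    then show ?thesis
      by (simp only: phi chi mj 1[THEN restrict_hom_of_cong])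
  next
    case 2
    then show ?thesis
      by (simp only: phi chi mj 2[THEN restrict_hom_of_cong] add.commute)
  qed
qed

text \<open>Cardinality is modular on the lattice of closed sets, and squaring makes it strictly
  supermodular on incomparable pairs.\<close>

lemma weight_meet_join_less:
  assumes "\<phi> \<in> Hom G Lambda" "\<chi> \<in> Hom G Lambda" "incomparable \<phi> \<chi>"
  shows "weight (hom_meet \<phi> \<chi>) + weight (hom_join \<phi> \<chi>) < weight \<phi> + weight \<chi>"
proof -
  define U W where "U = up_set \<phi>" and "W = up_set \<chi>"
  have sub: "U \<subseteq> verts G" "W \<subseteq> verts G" and fin: "finite U" "finite W"
    by (auto simp: U_def W_def up_set_subset finite_up_set)
  then have up: "up_set (hom_meet \<phi> \<chi>) = U \<inter> W" "up_set (hom_join \<phi> \<chi>) = U \<union> W"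
    unfolding hom_meet_def hom_join_def U_def W_def by (auto intro!: up_set_hom_of)
  have "card (U \<inter> W) < card U" "card (U \<inter> W) < card W"
    using assms(3) fin by (auto simp: incomparable_def U_def W_def intro!: psubset_card_mono)
  then obtain i j where ij: "card U = card (U \<inter> W) + i" "card W = card (U \<inter> W) + j" "0 < i" "0 < j"
    by (metis less_imp_add_positive)
  then have un: "card (U \<union> W) = card (U \<inter> W) + i + j"
    using card_Un_Int[OF fin] by simp
  \<comment> \<open>The two sides differ by \<open>2 * i * j\<close>, which is positive by
    incomparability.\<close>
  have "(card U)\<^sup>2 + (card W)\<^sup>2 < (card (U \<inter> W))\<^sup>2 + (card (U \<union> W))\<^sup>2"
    unfolding ij(1,2) un using ij(3,4) by (simp add: power2_eq_square algebra_simps)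
  moreover have "(card T)\<^sup>2 \<le> (card (verts G))\<^sup>2" if "T \<subseteq> verts G" for T
    using that finite_verts by (intro power_mono card_mono) auto
  then have "(card U)\<^sup>2 \<le> (card (verts G))\<^sup>2" "(card W)\<^sup>2 \<le> (card (verts G))\<^sup>2"
    "(card (U \<inter> W))\<^sup>2 \<le> (card (verts G))\<^sup>2" "(card (U \<union> W))\<^sup>2 \<le> (card (verts G))\<^sup>2"
    using sub by (simp_all add: le_infI1)
  ultimately show ?thesis
    unfolding weight_def up U_def[symmetric] W_def[symmetric] by linarith
qed

section \<open>Recovering a chain from its image\<close>

lemma edge_count_eq:
  assumes "e \<in> edges G" "mono_sum edge_monomial m = mono_sum edge_monomial n"
  shows "mono_sum (\<lambda>\<phi>. if P (restrict \<phi> e) then 1 else 0 :: nat) m =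
    mono_sum (\<lambda>\<phi>. if P (restrict \<phi> e) then 1 else 0) n"
proof -
  \<comment> \<open>\<open>h\<close> counts the image variables at \<open>e\<close> that satisfy
    \<open>P\<close>. Each factor contributes exactly one variable per edge, so \<open>h\<close> of
    its image is the indicator of \<open>P (restrict \<phi> e)\<close>.\<close>
  define h where "h = (\<lambda>(e', \<psi>). if e' = e \<and> P \<psi> then 1 else 0 :: nat)"
  have "mono_sum h (edge_monomial \<phi>) = (if P (restrict \<phi> e) then 1 else 0)" for \<phi>
  proof -
    have "mono_sum h (edge_monomial \<phi>) = (\<Sum>e'\<in>edges G. if e' = e then if P (restrict \<phi> e) then 1 else 0 else 0)"
      unfolding edge_monomial_def mono_sum_sum by (intro sum.cong) (auto simp: h_def)
    then show ?thesis
      using assms(1) finite_edges by (simp add: sum.delta)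
  qed
  then show ?thesis
    using arg_cong[OF assms(2), of "mono_sum h"] by (simp add: mono_sum_mono_sum)
qed

text \<open>A vertex with count 0 lies in every factor, so for a chain the vertices with count 0
  form its least member. Equal counts give \<open>m\<close> and \<open>n\<close> the same least
  factor; cancelling it leads to induction on the degree.\<close>

lemma chain_monomial_unique:
  assumes "m \<in> monomials (Hom G Lambda)" "n \<in> monomials (Hom G Lambda)"
    and "\<And>\<phi> \<chi>. \<phi> \<in> Poly_Mapping.keys m \<Longrightarrow> \<chi> \<in> Poly_Mapping.keys m \<Longrightarrow> \<not> incomparable \<phi> \<chi>"
    and "\<And>\<phi> \<chi>. \<phi> \<in> Poly_Mapping.keys n \<Longrightarrow> \<chi> \<in> Poly_Mapping.keys n \<Longrightarrow> \<not> incomparable \<phi> \<chi>"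
    and "mono_sum (\<lambda>_. 1 :: nat) m = mono_sum (\<lambda>_. 1) n"
    and "\<And>v. v \<in> verts G \<Longrightarrow> mono_sum (\<lambda>\<phi>. if v \<notin> up_set \<phi> then 1 else 0 :: nat) m =
      mono_sum (\<lambda>\<phi>. if v \<notin> up_set \<phi> then 1 else 0) n"
  shows "m = n"
  using assms
proof (induction "mono_sum (\<lambda>_. 1 :: nat) m" arbitrary: m n)
  case 0
  then have "mono_sum (\<lambda>_. 1 :: nat) m = 0" "mono_sum (\<lambda>_. 1 :: nat) n = 0" by simp_all
  then have "Poly_Mapping.keys m = {}" "Poly_Mapping.keys n = {}"
    unfolding mono_sum_nat_eq_0_iff by auto
  then show ?case
    by (intro poly_mapping_eqI) (auto simp: in_keys_iff)
next
  case (Suc d)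
  have least: "hom_of {v \<in> verts G. mono_sum (\<lambda>\<phi>. if v \<notin> up_set \<phi> then 1 else 0 :: nat) k = 0} \<in> Poly_Mapping.keys k"
    if k: "k \<in> monomials (Hom G Lambda)" "mono_sum (\<lambda>_. 1 :: nat) k = Suc d"
      "\<And>\<phi> \<chi>. \<phi> \<in> Poly_Mapping.keys k \<Longrightarrow> \<chi> \<in> Poly_Mapping.keys k \<Longrightarrow> \<not> incomparable \<phi> \<chi>" for k
  proof -
    have "Poly_Mapping.keys k \<noteq> {}"
      using k(2) by (auto simp: mono_sum_def)
    then obtain \<phi> where phi: "\<phi> \<in> Poly_Mapping.keys k"
      "\<And>\<chi>. \<chi> \<in> Poly_Mapping.keys k \<Longrightarrow> card (up_set \<phi>) \<le> card (up_set \<chi>)"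
      using ex_min_if_finite[of "(\<lambda>\<phi>. card (up_set \<phi>)) ` Poly_Mapping.keys k"] by (force simp: not_less)
    \<comment> \<open>In a chain a member of minimal cardinality is contained in all others.\<close>
    have "up_set \<phi> \<subseteq> up_set \<chi>" if "\<chi> \<in> Poly_Mapping.keys k" for \<chi>
      using k(3)[OF phi(1) that] phi(2)[OF that] card_seteq[OF finite_up_set[of \<phi>], of "up_set \<chi>"]
      by (auto simp: incomparable_def)
    then have "{v \<in> verts G. mono_sum (\<lambda>\<phi>. if v \<notin> up_set \<phi> then 1 else 0 :: nat) k = 0} = up_set \<phi>"
      using phi(1) up_set_subset unfolding mono_sum_nat_eq_0_iff by auto
    with phi(1) k(1) show ?thesis
      by (auto simp: monomials_def hom_of_up_set)
  qed
  define \<phi> where "\<phi> = hom_of {v \<in> verts G. mono_sum (\<lambda>\<phi>. if v \<notin> up_set \<phi> then 1 else 0 :: nat) m = 0}"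
  have "\<phi> = hom_of {v \<in> verts G. mono_sum (\<lambda>\<phi>. if v \<notin> up_set \<phi> then 1 else 0 :: nat) n = 0}"
    unfolding \<phi>_def using Suc.prems(6) by (intro arg_cong[of _ _ hom_of]) auto
  then have "\<phi> \<in> Poly_Mapping.keys m" "\<phi> \<in> Poly_Mapping.keys n"
    using least[of m] least[of n] Suc.prems Suc.hyps(2) by (auto simp: \<phi>_def)
  then obtain m' n' where m: "m = m' + Poly_Mapping.single \<phi> 1" and n: "n = n' + Poly_Mapping.single \<phi> 1"
    by (meson monomial_decomp)
  have "m' = n'"
  proof (rule Suc.hyps(1))
    show "d = mono_sum (\<lambda>_. 1) m'" "mono_sum (\<lambda>_. 1 :: nat) m' = mono_sum (\<lambda>_. 1) n'"
      using Suc.hyps(2) Suc.prems(5) by (simp_all add: m n mono_sum_add)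
    show "m' \<in> monomials (Hom G Lambda)" "n' \<in> monomials (Hom G Lambda)"
      using Suc.prems(1,2) by (auto simp: m n dest: monomials_addD)
    show "mono_sum (\<lambda>\<phi>. if v \<notin> up_set \<phi> then 1 else 0 :: nat) m' =
      mono_sum (\<lambda>\<phi>. if v \<notin> up_set \<phi> then 1 else 0) n'" if "v \<in> verts G" for v
      using Suc.prems(6)[OF that] unfolding m n mono_sum_add by (rule add_right_imp_eq)
  qed (use Suc.prems(3,4) in \<open>auto simp: m n keys_add_monomial\<close>)
  then show ?case by (simp add: m n)
qed

section \<open>The lattice binomials as straightening relations\<close>

sublocale straightening "Hom G Lambda" edge_monomial incomparable hom_meet hom_join weight
proof
  have "finite (verts G \<rightarrow>\<^sub>E verts Lambda)"
    using finite_verts by (intro finite_PiE) (simp_all add: Lambda_def)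
  then show "finite (Hom G Lambda)"
    by (rule rev_finite_subset) (auto simp: Hom_def)
  show "a \<noteq> b" if "incomparable a b" for a b
    using that by (auto simp: incomparable_def)
  fix m n
  assume mn: "m \<in> monomials (Hom G Lambda)" "n \<in> monomials (Hom G Lambda)"
    "\<And>a b. a \<in> Poly_Mapping.keys m \<Longrightarrow> b \<in> Poly_Mapping.keys m \<Longrightarrow> \<not> incomparable a b"
    "\<And>a b. a \<in> Poly_Mapping.keys n \<Longrightarrow> b \<in> Poly_Mapping.keys n \<Longrightarrow> \<not> incomparable a b"
    and eq: "mono_sum edge_monomial m = mono_sum edge_monomial n"
  show "m = n"
  proof (rule chain_monomial_unique[OF mn])
    \<comment> \<open>Every factor contributes one variable at any given edge, so counting the
      variables at a single edge yields the degree.\<close>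
    obtain e where "e \<in> edges G"
      using cov by (auto simp: covered_by_edges_def)
    from edge_count_eq[OF this eq, of "\<lambda>_. True"]
    show "mono_sum (\<lambda>_. 1 :: nat) m = mono_sum (\<lambda>_. 1) n"
      by (simp only: if_True)
  next
    fix v assume v: "v \<in> verts G"
    then obtain e where e: "e \<in> edges G" "v \<in> e"
      using cov by (auto simp: covered_by_edges_def)
    \<comment> \<open>Whether \<open>v\<close> lies in the up-set is already visible on any edge
      through \<open>v\<close>, so the count at \<open>v\<close> is read off from the variables of
      that edge.\<close>
    have "(restrict \<phi> e v = Unlooped \<longleftrightarrow> v \<in> V1) \<longleftrightarrow> v \<in> up_set \<phi>" for \<phi>
      using v e(2) by (simp add: up_set_def)
    then show "mono_sum (\<lambda>\<phi>. if v \<notin> up_set \<phi> then 1 else 0 :: nat) m =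
      mono_sum (\<lambda>\<phi>. if v \<notin> up_set \<phi> then 1 else 0) n"
      using edge_count_eq[OF e(1) eq, of "\<lambda>\<psi>. \<not> (\<psi> v = Unlooped \<longleftrightarrow> v \<in> V1)"]
      by (simp only:)
  qed
qed (fact hom_meet_mem hom_join_mem edge_monomial_meet_join weight_meet_join_less)+

lemma toric_ideal_eq: "(toric_ideal :: (_, 'k::field) mvpoly set) = hom_ideal G Lambda"
proof -
  have "edge_separator_map G Lambda = poly_subst (\<lambda>\<phi>. mono_poly (edge_monomial \<phi>) :: (_, 'k) mvpoly)"
    by (simp add: edge_separator_map_def edge_monomial_def var_def mono_poly_prod)
  then show ?thesis
    by (simp add: toric_ideal_def hom_ideal_def a_kernel_def' R_ring_def S_ring_def poly_ring_def)
qed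

lemma indep_var_eq:
  assumes "A \<subseteq> V1" "B \<subseteq> V2"
  shows "indep_var G A B = var (hom_of (A \<union> (V2 - B)))"
proof -
  have "(A \<union> (V2 - B)) \<inter> V1 \<union> (V2 - (A \<union> (V2 - B))) = A \<union> B"
    using assms parts_disjoint by auto
  then show ?thesis by (simp add: indep_var_def hom_of_def)
qed

text \<open>Complementing in \<open>V2\<close> exchanges union and intersection there, so both
  operations on the pairs become intersection and union of closed sets. The binomial vanishes
  exactly for comparable pairs, hence removing 0 amounts to requiring incomparability.\<close>

lemma lattice_binomials_eq: "lattice_binomials G V1 V2 - {0} = (relations :: (_, 'k::field) mvpoly set)"
proof (intro equalityI subsetI)
  fix f :: "('a \<Rightarrow> lam, 'k) mvpoly" assume "f \<in> lattice_binomials G V1 V2 - {0}"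
  then obtain A B C D where "f \<noteq> 0"
    and f: "f = indep_var G A B * indep_var G C D - indep_var G (A \<inter> C) (B \<union> D) * indep_var G (A \<union> C) (B \<inter> D)"
    and sub: "A \<subseteq> V1" "C \<subseteq> V1" "B \<subseteq> V2" "D \<subseteq> V2" and ind: "independent G (A \<union> B)" "independent G (C \<union> D)"
    by (auto simp: lattice_binomials_def)
  define U W where "U = A \<union> (V2 - B)" and "W = C \<union> (V2 - D)"
  have cl: "closed U" "closed W"
    using sub ind closed_of_independent by (auto simp: U_def W_def)
  have up: "up_set (hom_of U) = U" "up_set (hom_of W) = W"
    using cl by (auto simp: closed_def intro!: up_set_hom_of)
  have "A \<inter> C \<union> (V2 - (B \<union> D)) = U \<inter> W" "A \<union> C \<union> (V2 - B \<inter> D) = U \<union> W"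
    using sub parts_disjoint by (auto simp: U_def W_def)
  then have f': "f = var (hom_of U) * var (hom_of W) - var (hom_of (U \<inter> W)) * var (hom_of (U \<union> W))"
    using sub indep_var_eq[of "A \<inter> C" "B \<union> D"] indep_var_eq[of "A \<union> C" "B \<inter> D"]
    by (simp add: f indep_var_eq U_def W_def le_infI1)
  \<comment> \<open>If one set contained the other, their intersection and union would be
    \<open>U\<close> and \<open>W\<close> again, and the two products would cancel.\<close>
  have "\<not> U \<subseteq> W" "\<not> W \<subseteq> U"
    using \<open>f \<noteq> 0\<close> unfolding f' by (auto simp: Int_absorb1 Int_absorb2 Un_absorb1 Un_absorb2 mult.commute)
  then have "incomparable (hom_of U) (hom_of W)"
    by (simp add: incomparable_def up)
  moreover have "f = var (hom_of U) * var (hom_of W)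
      - var (hom_meet (hom_of U) (hom_of W)) * var (hom_join (hom_of U) (hom_of W))"
    by (simp add: f' hom_meet_def hom_join_def up)
  ultimately show "f \<in> relations"
    using hom_of_mem[OF cl(1)] hom_of_mem[OF cl(2)] unfolding relations_def by blast
next
  fix f :: "('a \<Rightarrow> lam, 'k) mvpoly" assume "f \<in> relations"
  then obtain \<phi> \<chi> where f: "f = var \<phi> * var \<chi> - var (hom_meet \<phi> \<chi>) * var (hom_join \<phi> \<chi>)"
    and mem: "\<phi> \<in> Hom G Lambda" "\<chi> \<in> Hom G Lambda" and inc: "incomparable \<phi> \<chi>"
    by (auto simp: relations_def)
  have "f \<noteq> 0"
    using keys_relation[OF mem inc, where 'k = 'k] by (auto simp: f)
  define U W where "U = up_set \<phi>" and "W = up_set \<chi>"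
  define A B C D where "A = U \<inter> V1" and "B = V2 - U" and "C = W \<inter> V1" and "D = V2 - W"
  have cl: "closed U" "closed W"
    using mem by (auto simp: U_def W_def closed_up_set)
  have sub: "A \<subseteq> V1" "C \<subseteq> V1" "B \<subseteq> V2" "D \<subseteq> V2"
    by (auto simp: A_def B_def C_def D_def)
  have ind: "independent G (A \<union> B)" "independent G (C \<union> D)"
    using cl independent_of_closed by (auto simp: A_def B_def C_def D_def)
  have "A \<union> (V2 - B) = U" "C \<union> (V2 - D) = W"
    "A \<inter> C \<union> (V2 - (B \<union> D)) = U \<inter> W" "A \<union> C \<union> (V2 - B \<inter> D) = U \<union> W"
    using cl verts_eq by (auto simp: A_def B_def C_def D_def closed_def)
  then have "f = indep_var G A B * indep_var G C D - indep_var G (A \<inter> C) (B \<union> D) * indep_var G (A \<union> C) (B \<inter> D)"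
    using sub indep_var_eq[of "A \<inter> C" "B \<union> D"] indep_var_eq[of "A \<union> C" "B \<inter> D"] mem
    by (simp add: f indep_var_eq le_infI1 hom_meet_def hom_join_def hom_of_up_set flip: U_def W_def)
      (simp add: U_def W_def hom_of_up_set)
  then show "f \<in> lattice_binomials G V1 V2 - {0}"
    using \<open>f \<noteq> 0\<close> sub ind unfolding lattice_binomials_def by blast
qed

end

theorem theorem7p5:
  fixes G :: "'a ugraph" and V1 V2 :: "'a set"
  assumes "finite_graph G"
    and "bipartite G V1 V2"
    and "covered_by_edges G"
  shows "\<exists>ord. monomial_order (Hom G Lambda) ord \<and>
    groebner_basis (Hom G Lambda) ord (hom_ideal G Lambda :: ('a \<Rightarrow> lam, 'k::field) mvpoly set)
      (lattice_binomials G V1 V2 - {0}) \<and>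
    (\<forall>g \<in> lattice_binomials G V1 V2 - {0} :: ('a \<Rightarrow> lam, 'k) mvpoly set.
      quadratic g \<and> squarefree_mono (lead_monomial ord g))"
proof -
  interpret bipartite_hom G V1 V2
    using assms by unfold_locales
  show ?thesis
    using groebner_basis_relations[where 'k = 'k]
    unfolding toric_ideal_eq lattice_binomials_eq .
qed

end
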